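(* For all $k_0\le k_1$ in $\{0,1,2,3\}$ there exist a $6$-nilmanifold $M$, depending on $k_0,k_1$, and a left-invariant almost complex structure $J_0$ on $M$ such that $$\operatorname{rk}N_{J_0}=k_0,$$ and in any neighborhood of $J_0$ there are left-invariant almost complex structures of rank $k_1$.
   Context: A $6$-nilmanifold is a compact quotient $\Gamma\backslash G$ of a $6$-dimensional connected, simply connected nilpotent real Lie group $G$ by a lattice $\Gamma$. An almost complex structure on $M$ is left-invariant if it is induced by a left-invariant almost complex structure on $G$, equivalently by an endomorphism $J$ with $J^2=-\mathrm{Id}$ of the Lie algebra $\mathfrak g$ of $G$. Rank: the operator $\bar\mu:=\pi^{0,2}\circ d\colon A^{1,0}\to A^{0,2}$ (where $\pi^{0,2}$ is the projection of complex $2$-forms onto $(0,2)$-forms with respect to $J$) is linear over smooth functions; the rank of $J$, or $\operatorname{rk}N_J$, at $x$ is by definition the complex rank of $\bar\mu\colon A^{1,0}_x\to A^{0,2}_x$. For left-invariant $J$ it does not depend on $x$. *)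

theory Defs
  imports "HOL-Analysis.Analysis" "HOL-Algebra.Generated_Groups"
begin

text \<open>\<open>C\<^sup>k\<close> and smooth maps on an open subset of a finite-dimensional space. Continuity of all
  iterated directional derivatives is the usual notion there.\<close>

primrec Ck_on :: "nat \<Rightarrow> ('a::real_normed_vector \<Rightarrow> 'b::real_normed_vector) \<Rightarrow> 'a set \<Rightarrow> bool" where
  "Ck_on 0 f S \<longleftrightarrow> continuous_on S f"
| "Ck_on (Suc k) f S \<longleftrightarrow>
     (\<forall>x\<in>S. f differentiable (at x)) \<and> (\<forall>v. Ck_on k (\<lambda>x. frechet_derivative f (at x) v) S)"

definition smooth_on :: "('a::real_normed_vector \<Rightarrow> 'b::real_normed_vector) \<Rightarrow> 'a set \<Rightarrow> bool" where
  "smooth_on f S \<longleftrightarrow> (\<forall>k. Ck_on k f S)"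

text \<open>A Lie group presented in one global chart: its underlying manifold is an open subset of
  \<open>\<real>\<^sup>n\<close>. For connected, simply connected nilpotent groups this is no restriction, since their
  exponential map is a global diffeomorphism. All tangent spaces are thereby identified
  with \<open>\<real>\<^sup>n\<close>.\<close>

definition lie_group :: "(real^'n) monoid \<Rightarrow> bool" where
  "lie_group G \<longleftrightarrow> group G \<and> open (carrier G) \<and>
     smooth_on (\<lambda>(x, y). x \<otimes>\<^bsub>G\<^esub> y) (carrier G \<times> carrier G) \<and>
     smooth_on (\<lambda>x. inv\<^bsub>G\<^esub> x) (carrier G)"

primrec lower_central :: "('a, 'b) monoid_scheme \<Rightarrow> nat \<Rightarrow> 'a set" where
  "lower_central G 0 = carrier G"
| "lower_central G (Suc n) = generate G
     (\<Union>g \<in> carrier G. \<Union>h \<in> lower_central G n. {g \<otimes>\<^bsub>G\<^esub> h \<otimes>\<^bsub>G\<^esub> inv\<^bsub>G\<^esub> g \<otimes>\<^bsub>G\<^esub> inv\<^bsub>G\<^esub> h})"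

definition nilpotent_group :: "('a, 'b) monoid_scheme \<Rightarrow> bool" where
  "nilpotent_group G \<longleftrightarrow> group G \<and> (\<exists>n. lower_central G n = {\<one>\<^bsub>G\<^esub>})"

text \<open>The points of \<open>\<Gamma>\<setminus>G\<close> are the cosets \<open>\<Gamma> g\<close>. The topology \<open>X\<close> below is uniquely determined:
  it is the quotient topology on the set of these cosets.\<close>

definition cocompact_lattice :: "(real^'n) monoid \<Rightarrow> (real^'n) set \<Rightarrow> bool" where
  "cocompact_lattice G \<Gamma> \<longleftrightarrow> subgroup \<Gamma> G \<and> discrete \<Gamma> \<and>
     (\<exists>X. quotient_map (top_of_set (carrier G)) X (\<lambda>g. \<Gamma> #>\<^bsub>G\<^esub> g) \<and> compact_space X)"

definition nilmanifold :: "(real^'n) monoid \<Rightarrow> (real^'n) set \<Rightarrow> bool" where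
  "nilmanifold G \<Gamma> \<longleftrightarrow> lie_group G \<and> connected (carrier G) \<and> simply_connected (carrier G) \<and>
     nilpotent_group G \<and> cocompact_lattice G \<Gamma>"

definition dL :: "(real^'n) monoid \<Rightarrow> real^'n \<Rightarrow> real^'n \<Rightarrow> real^'n^'n" where
  "dL G g x = matrix (frechet_derivative (\<lambda>y. g \<otimes>\<^bsub>G\<^esub> y) (at x))"

definition almost_complex_structure :: "(real^'n) monoid \<Rightarrow> (real^'n \<Rightarrow> real^'n^'n) \<Rightarrow> bool" where
  "almost_complex_structure G J \<longleftrightarrow>
     smooth_on J (carrier G) \<and> (\<forall>x\<in>carrier G. J x ** J x = - mat 1)"

text \<open>Left-invariant almost complex structures on \<open>G\<close>; these descend to \<open>\<Gamma>\<setminus>G\<close> and are by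
  definition the left-invariant almost complex structures there.\<close>

definition left_invariant_acs :: "(real^'n) monoid \<Rightarrow> (real^'n \<Rightarrow> real^'n^'n) set" where
  "left_invariant_acs G = {J. almost_complex_structure G J \<and>
     (\<forall>g\<in>carrier G. \<forall>x\<in>carrier G. dL G g x ** J x = J (g \<otimes>\<^bsub>G\<^esub> x) ** dL G g x)}"

text \<open>A left-invariant \<open>J\<close> is determined on \<open>G\<close> by the endomorphism \<open>J \<one>\<close> of the Lie algebra
  \<open>T\<^sub>1 G\<close>, and the left-invariant structures carry the topology of \<open>End (T\<^sub>1 G)\<close>. Since left-invariant
  endomorphism fields form a finite-dimensional space, the \<open>C\<^sup>k\<close> and \<open>C\<^sup>\<infinity>\<close> topologies on almost
  complex structures of \<open>\<Gamma>\<setminus>G\<close> induce the same one.\<close>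

definition left_invariant_acs_topology ::
    "(real^'n) monoid \<Rightarrow> (real^'n \<Rightarrow> real^'n^'n) topology" where
  "left_invariant_acs_topology G =
     pullback_topology (left_invariant_acs G) (\<lambda>J. J \<one>\<^bsub>G\<^esub>) euclidean"

text \<open>A complex covector is its row of components; \<open>\<alpha> v* A\<close> is the covector \<open>\<alpha> \<circ> A\<close>. A complex
  2-form at a point is the matrix \<open>B\<close> with \<open>\<beta>(u, v) = (\<Sum>i j. B $ i $ j * u $ i * v $ j)\<close>.\<close>

abbreviation complexify :: "real^'n^'m \<Rightarrow> complex^'n^'m" where
  "complexify \<equiv> map_matrix complex_of_real"

definition cmat_scale :: "complex \<Rightarrow> complex^'n^'m \<Rightarrow> complex^'n^'m" where
  "cmat_scale c B = map_matrix (\<lambda>z. c * z) B"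

interpretation cmat: vector_space "cmat_scale :: complex \<Rightarrow> complex^'n^'m \<Rightarrow> complex^'n^'m"
  by unfold_locales (simp_all add: cmat_scale_def vec_eq_iff algebra_simps)

text \<open>Forms on \<open>\<Gamma>\<setminus>G\<close> are the \<open>\<Gamma>\<close>-invariant forms on \<open>G\<close>, via pullback along the covering
  \<open>G \<rightarrow> \<Gamma>\<setminus>G\<close>. The \<open>(1,0)\<close>-forms are those with \<open>\<omega> \<circ> J = \<i> \<omega>\<close>.\<close>

definition A10 :: "(real^'n) monoid \<Rightarrow> (real^'n) set \<Rightarrow> (real^'n \<Rightarrow> real^'n^'n) \<Rightarrow>
    (real^'n \<Rightarrow> complex^'n) set" where
  "A10 G \<Gamma> J = {\<omega>. smooth_on \<omega> (carrier G) \<and>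
     (\<forall>\<gamma>\<in>\<Gamma>. \<forall>x\<in>carrier G. \<omega> (\<gamma> \<otimes>\<^bsub>G\<^esub> x) v* complexify (dL G \<gamma> x) = \<omega> x) \<and>
     (\<forall>x\<in>carrier G. \<omega> x v* complexify (J x) = \<i> *s \<omega> x)}"

definition ext_d :: "(real^'n \<Rightarrow> complex^'n) \<Rightarrow> real^'n \<Rightarrow> complex^'n^'n" where
  "ext_d \<omega> x = (\<chi> i j. frechet_derivative \<omega> (at x) (axis i 1) $ j
                    - frechet_derivative \<omega> (at x) (axis j 1) $ i)"

text \<open>\<open>proj_T01 J\<close> projects the complexified tangent space onto the \<open>-\<i>\<close>-eigenspace \<open>T\<^sup>0\<^sup>,\<^sup>1\<close> of \<open>J\<close>
  along the \<open>\<i>\<close>-eigenspace, and \<open>(\<pi>\<^sup>0\<^sup>,\<^sup>2 \<beta>)(u, v) = \<beta>(u\<^sup>0\<^sup>,\<^sup>1, v\<^sup>0\<^sup>,\<^sup>1)\<close>.\<close>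

definition proj_T01 :: "real^'n^'n \<Rightarrow> complex^'n^'n" where
  "proj_T01 J = cmat_scale (1/2) (mat 1 + cmat_scale \<i> (complexify J))"

definition proj02 :: "real^'n^'n \<Rightarrow> complex^'n^'n \<Rightarrow> complex^'n^'n" where
  "proj02 J B = transpose (proj_T01 J) ** B ** proj_T01 J"

definition mubar :: "(real^'n \<Rightarrow> real^'n^'n) \<Rightarrow> (real^'n \<Rightarrow> complex^'n) \<Rightarrow> real^'n \<Rightarrow> complex^'n^'n" where
  "mubar J \<omega> x = proj02 (J x) (ext_d \<omega> x)"

text \<open>The complex rank of \<open>\<mu>\<close>-bar at \<open>\<Gamma> x\<close>. As \<open>\<mu>\<close>-bar is linear over functions and every element
  of \<open>A\<^sup>1\<^sup>,\<^sup>0\<close> at a point extends to a global \<open>(1,0)\<close>-form, the set below is the image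
  of the pointwise map from the fibre of \<open>A\<^sup>1\<^sup>,\<^sup>0\<close> to the fibre of \<open>A\<^sup>0\<^sup>,\<^sup>2\<close>.\<close>

definition rk_N :: "(real^'n) monoid \<Rightarrow> (real^'n) set \<Rightarrow> (real^'n \<Rightarrow> real^'n^'n) \<Rightarrow> real^'n \<Rightarrow> nat" where
  "rk_N G \<Gamma> J x = cmat.dim ((\<lambda>\<omega>. mubar J \<omega> x) ` A10 G \<Gamma> J)"

end

theory Submission
  imports Defs
begin

text \<open>
  The rank of a left-invariant \<open>J\<close> is a matter of linear algebra in the Lie algebra. The operator
  \<open>\<mu>\<close>-bar is tensorial (\<open>mubar_tensorial\<close>), so its image at a point is reached by left-invariant
  \<open>(1,0)\<close>-forms \<open>\<alpha>\<close>, and for these \<open>d\<alpha>(u, v) = - \<alpha>([u, v])\<close>. If \<open>Z\<^sub>1, Z\<^sub>2, Z\<^sub>3\<close> is a basis of \<open>T\<^sup>0\<^sup>,\<^sup>1\<close>,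
  the rank is therefore the rank of the linear map taking \<open>\<alpha>\<close> to the three numbers
  \<open>\<alpha>([Z\<^sub>i, Z\<^sub>j])\<close>, \<open>i < j\<close>. This is \<open>rk_N_left_field\<close>.

  The groups are a family with real parameters \<open>a\<close>, \<open>c\<close> and brackets
  \<open>[e\<^sub>1, e\<^sub>2] = 2a e\<^sub>3\<close>, \<open>[e\<^sub>1, e\<^sub>3] = c e\<^sub>4\<close>, \<open>[e\<^sub>2, e\<^sub>3] = c e\<^sub>5\<close>, with lattice the integer points. The real
  commutator algebra has dimension at most \<open>1\<close> if \<open>c = 0\<close> and at most \<open>2\<close> if \<open>a = 0\<close>, which caps the rank. With
  \<open>a, c \<in> {0, 1}\<close> and \<open>k\<^sub>1 = a + 2c\<close> this cap is \<open>k\<^sub>1\<close>, and it remains to find a structure of rank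
  \<open>k\<^sub>0\<close> that can be deformed to structures attaining it. Two curves suffice.

  The curve \<open>J_plane s t\<close> with \<open>s = \<plusminus>1\<close> keeps the plane of \<open>e\<^sub>1, e\<^sub>2\<close> complex. At \<open>t = 0\<close> one has
  \<open>Z\<^sub>1 = e\<^sub>1 + \<i>e\<^sub>2\<close>, \<open>Z\<^sub>3 = e\<^sub>3 + \<i>e\<^sub>6\<close> and \<open>Z\<^sub>2 = e\<^sub>4 + \<i>s e\<^sub>5\<close>, so that the only bracket is
  \<open>[Z\<^sub>1, Z\<^sub>3] = c (e\<^sub>4 + \<i>e\<^sub>5)\<close>. It lies in \<open>T\<^sup>0\<^sup>,\<^sup>1\<close> for \<open>s = 1\<close> and in \<open>T\<^sup>1\<^sup>,\<^sup>0\<close> for \<open>s = -1\<close>: the rank is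
  \<open>0\<close> or \<open>c\<close>. Replacing \<open>e\<^sub>4\<close> by \<open>e\<^sub>4 + t e\<^sub>2\<close> in this recipe makes the rank \<open>a + 2c\<close> for every \<open>t \<noteq> 0\<close>.
  This gives all pairs with \<open>k\<^sub>0 < k\<^sub>1\<close> but \<open>(2, 3)\<close>, for which \<open>J_split\<close> is made; if \<open>k\<^sub>0 = k\<^sub>1\<close>, any
  structure of that rank will do.
\<close>

section \<open>Smooth maps\<close>

lemma Ck_on_const: "Ck_on k (\<lambda>_. c) UNIV"
  by (induction k arbitrary: c) simp_all

text \<open>Differentiation lowers the order by one, so in a product the undifferentiated factor has to be
  seen as one of lower order; this is what makes the induction for bilinear maps close.\<close>
lemma Ck_on_SucD: "Ck_on (Suc k) f UNIV \<Longrightarrow> Ck_on k f UNIV"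
proof (induction k arbitrary: f)
  case 0
  then show ?case
    by (simp add: continuous_on_eq_continuous_at differentiable_imp_continuous_within)
next
  case (Suc k)
  have "Ck_on k (\<lambda>x. frechet_derivative f (at x) v) UNIV" for v
    using Suc.prems by (intro Suc.IH) simp
  with Suc.prems show ?case by simp
qed

lemma Ck_on_add:
  "Ck_on k f UNIV \<Longrightarrow> Ck_on k g UNIV \<Longrightarrow> Ck_on k (\<lambda>x. f x + g x) UNIV"
proof (induction k arbitrary: f g)
  case 0
  then show ?case by (simp add: continuous_on_add)
next
  case (Suc k)
  have "frechet_derivative (\<lambda>x. f x + g x) (at x) v
      = frechet_derivative f (at x) v + frechet_derivative g (at x) v" for x v
    using Suc.prems frechet_derivative_at[OF has_derivative_add, of f _ x g]
    by (simp add: frechet_derivative_works) metis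
  with Suc show ?case by simp
qed

lemma Ck_on_linear_compose:
  assumes "bounded_linear L"
  shows "Ck_on k f UNIV \<Longrightarrow> Ck_on k (\<lambda>x. L (f x)) UNIV"
proof (induction k arbitrary: f)
  case 0
  then show ?case using bounded_linear.continuous_on[OF assms] by simp
next
  case (Suc k)
  have D: "((\<lambda>x. L (f x)) has_derivative (\<lambda>v. L (frechet_derivative f (at x) v))) (at x)" for x
    using Suc.prems by (intro bounded_linear.has_derivative[OF assms])
      (simp add: frechet_derivative_works[symmetric])
  have "frechet_derivative (\<lambda>x. L (f x)) (at x) v = L (frechet_derivative f (at x) v)" for x v
    using frechet_derivative_at[OF D] by metis
  moreover have "(\<lambda>x. L (f x)) differentiable (at x)" for x
    using D differentiableI by blast
  ultimately show ?case using Suc by simp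
qed

lemma Ck_on_bilinear:
  assumes "bounded_bilinear B"
  shows "Ck_on k f UNIV \<Longrightarrow> Ck_on k g UNIV \<Longrightarrow> Ck_on k (\<lambda>x. B (f x) (g x)) UNIV"
proof (induction k arbitrary: f g)
  case 0
  then show ?case using bounded_bilinear.continuous_on[OF assms] by simp
next
  case (Suc k)
  have D: "((\<lambda>x. B (f x) (g x)) has_derivative
      (\<lambda>v. B (f x) (frechet_derivative g (at x) v) + B (frechet_derivative f (at x) v) (g x))) (at x)" for x
    using Suc.prems by (intro bounded_bilinear.FDERIV[OF assms])
      (simp_all add: frechet_derivative_works[symmetric])
  have E: "frechet_derivative (\<lambda>x. B (f x) (g x)) (at x) v =
      B (f x) (frechet_derivative g (at x) v) + B (frechet_derivative f (at x) v) (g x)" for x v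
    using frechet_derivative_at[OF D] by metis
  have "(\<lambda>x. B (f x) (g x)) differentiable (at x)" for x
    using D differentiableI by blast
  moreover have "Ck_on k (\<lambda>x. B (f x) (frechet_derivative g (at x) v)
      + B (frechet_derivative f (at x) v) (g x)) UNIV" for v
    using Suc.prems by (intro Ck_on_add Suc.IH) (auto dest: Ck_on_SucD simp del: Ck_on.simps(2), auto)
  ultimately show ?case by (simp add: E)
qed

lemma smooth_on_const: "smooth_on (\<lambda>_. c) UNIV"
  by (simp add: smooth_on_def Ck_on_const)

lemma smooth_on_linear:
  assumes "bounded_linear L"
  shows "smooth_on L UNIV"
proof -
  have "Ck_on k (\<lambda>x::'a. x) UNIV" for k
    by (cases k) (simp_all add: Ck_on_const frechet_derivative_ident)
  from Ck_on_linear_compose[OF assms this] show ?thesis by (simp add: smooth_on_def)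
qed

lemma smooth_on_add:
  "smooth_on f UNIV \<Longrightarrow> smooth_on g UNIV \<Longrightarrow> smooth_on (\<lambda>x. f x + g x) UNIV"
  by (simp add: smooth_on_def Ck_on_add)

lemma smooth_on_linear_compose:
  "bounded_linear L \<Longrightarrow> smooth_on f UNIV \<Longrightarrow> smooth_on (\<lambda>x. L (f x)) UNIV"
  by (simp add: smooth_on_def Ck_on_linear_compose)

lemma smooth_on_mult:
  fixes f g :: "'a::real_normed_vector \<Rightarrow> 'b::real_normed_algebra"
  shows "smooth_on f UNIV \<Longrightarrow> smooth_on g UNIV \<Longrightarrow> smooth_on (\<lambda>x. f x * g x) UNIV"
  by (simp add: smooth_on_def Ck_on_bilinear[OF bounded_bilinear_mult])

lemma smooth_on_sum:
  "(\<And>i. i \<in> I \<Longrightarrow> smooth_on (f i) UNIV) \<Longrightarrow> smooth_on (\<lambda>x. \<Sum>i\<in>I. f i x) UNIV"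
  by (induction I rule: infinite_finite_induct) (simp_all add: smooth_on_const smooth_on_add)

lemma smooth_on_power:
  fixes f :: "'a::real_normed_vector \<Rightarrow> 'b::real_normed_algebra_1"
  shows "smooth_on f UNIV \<Longrightarrow> smooth_on (\<lambda>x. f x ^ n) UNIV"
  by (induction n) (simp_all add: smooth_on_const smooth_on_mult)

lemma smooth_on_minus: "smooth_on f UNIV \<Longrightarrow> smooth_on (\<lambda>x. - f x) UNIV"
  by (rule smooth_on_linear_compose[OF bounded_linear_minus[OF bounded_linear_ident]])

lemma smooth_on_diff:
  "smooth_on f UNIV \<Longrightarrow> smooth_on g UNIV \<Longrightarrow> smooth_on (\<lambda>x. f x - g x) UNIV"
  using smooth_on_add[OF _ smooth_on_minus, of f g] by simp

lemma sum_axis_nth: "(\<Sum>i\<in>UNIV. axis i (v $ i)) = v" for v :: "'b::comm_monoid_add^'n"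
proof -
  have "(\<Sum>i\<in>UNIV. axis i (v $ i)) $ j = v $ j" for j
  proof -
    have "(\<Sum>i\<in>UNIV. axis i (v $ i)) $ j = (\<Sum>i\<in>UNIV. if j = i then v $ i else 0)"
      unfolding sum_component axis_def by (intro sum.cong) auto
    also have "\<dots> = v $ j" by (subst sum.delta') auto
    finally show ?thesis .
  qed
  then show ?thesis by (rule vec_eq_iff[THEN iffD2, rule_format])
qed

lemma bounded_linear_axis: "bounded_linear (axis i :: 'b::euclidean_space \<Rightarrow> 'b^'n)"
  by (auto simp: linear_conv_bounded_linear[symmetric] axis_def vec_eq_iff intro!: linearI)

text \<open>The reduction to components through which every polynomial map below is seen to be smooth.\<close>
lemma smooth_on_vec:
  fixes f :: "'a::real_normed_vector \<Rightarrow> 'b::euclidean_space^'n"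
  assumes "\<And>i. smooth_on (\<lambda>x. f x $ i) UNIV"
  shows "smooth_on f UNIV"
proof -
  have "smooth_on (\<lambda>x. \<Sum>i\<in>UNIV. axis i (f x $ i)) UNIV"
    using assms by (intro smooth_on_sum smooth_on_linear_compose[OF bounded_linear_axis])
  then show ?thesis by (simp add: sum_axis_nth)
qed

lemma smooth_on_nth:
  fixes f :: "'a::real_normed_vector \<Rightarrow> 'b::real_normed_vector^'n"
  shows "smooth_on f UNIV \<Longrightarrow> smooth_on (\<lambda>x. f x $ i) UNIV"
  by (rule smooth_on_linear_compose[OF bounded_linear_vec_nth])

lemma has_derivative_vec:
  fixes f :: "'a::real_normed_vector \<Rightarrow> 'b::euclidean_space^'n"
  assumes "\<And>i. ((\<lambda>x. f x $ i) has_derivative (\<lambda>h. f' h $ i)) F"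
  shows "(f has_derivative f') F"
proof -
  have "((\<lambda>x. \<Sum>i\<in>UNIV. axis i (f x $ i)) has_derivative (\<lambda>h. \<Sum>i\<in>UNIV. axis i (f' h $ i))) F"
    using assms by (intro has_derivative_sum bounded_linear.has_derivative[OF bounded_linear_axis])
  then show ?thesis by (simp add: sum_axis_nth)
qed

section \<open>Vectors and matrices of size six\<close>

lemma exhaust_6: "x = 1 \<or> x = 2 \<or> x = 3 \<or> x = 4 \<or> x = 5 \<or> x = 6" for x :: 6
proof (induct x)
  case (of_int z)
  then have "z = 0 \<or> z = 1 \<or> z = 2 \<or> z = 3 \<or> z = 4 \<or> z = 5" by fastforce
  then show ?case by auto
qed

lemma forall_6: "(\<forall>i::6. P i) \<longleftrightarrow> P 1 \<and> P 2 \<and> P 3 \<and> P 4 \<and> P 5 \<and> P 6"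
  by (metis exhaust_6)

lemma sum_6: "sum f (UNIV::6 set) = f 1 + f 2 + f 3 + f 4 + f 5 + f 6"
proof -
  have *: "UNIV = {1, 2, 3, 4, 5, 6::6}" using exhaust_6 by auto
  show ?thesis unfolding * by (simp add: ac_simps)
qed

lemma vector_6 [simp]:
  "(vector [a, b, c, d, e, f] :: ('a::zero)^6) $ 1 = a"
  "(vector [a, b, c, d, e, f] :: ('a::zero)^6) $ 2 = b"
  "(vector [a, b, c, d, e, f] :: ('a::zero)^6) $ 3 = c"
  "(vector [a, b, c, d, e, f] :: ('a::zero)^6) $ 4 = d"
  "(vector [a, b, c, d, e, f] :: ('a::zero)^6) $ 5 = e"
  "(vector [a, b, c, d, e, f] :: ('a::zero)^6) $ 6 = f"
  unfolding vector_def by simp_all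

section \<open>A two-parameter family of nilmanifolds\<close>

text \<open>The group of the Lie algebra \<open>[e\<^sub>1, e\<^sub>2] = 2a e\<^sub>3\<close>, \<open>[e\<^sub>1, e\<^sub>3] = c e\<^sub>4\<close>, \<open>[e\<^sub>2, e\<^sub>3] = c e\<^sub>5\<close>. For
  \<open>a = c = 1\<close> it is, up to isomorphism, the product of \<open>\<real>\<close> with the free 3-step nilpotent group on two
  generators; \<open>c = 0\<close> leaves at most a Heisenberg factor, and \<open>a = 0\<close> a group of step at most two. The
  factor \<open>2\<close> clears the denominators that the group law would have otherwise, so that for integers
  \<open>a\<close> and \<open>c\<close> the integer points form a subgroup.\<close>
definition nil_mult :: "real \<Rightarrow> real \<Rightarrow> real^6 \<Rightarrow> real^6 \<Rightarrow> real^6" where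
  "nil_mult a c x y = vector [x$1 + y$1, x$2 + y$2, x$3 + y$3 + 2 * a * x$1 * y$2,
     x$4 + y$4 + c * (x$1 * y$3 + a * (x$1)^2 * y$2),
     x$5 + y$5 - c * (x$3 * y$2 + a * x$1 * (y$2)^2), x$6 + y$6]"

definition nil_inv :: "real \<Rightarrow> real \<Rightarrow> real^6 \<Rightarrow> real^6" where
  "nil_inv a c x = vector [- x$1, - x$2, - x$3 + 2 * a * x$1 * x$2,
     - x$4 + c * (x$1 * x$3 - a * (x$1)^2 * x$2),
     - x$5 + c * (a * x$1 * (x$2)^2 - x$3 * x$2), - x$6]"

definition nil_group :: "real \<Rightarrow> real \<Rightarrow> (real^6) monoid" where
  "nil_group a c = \<lparr>carrier = UNIV, mult = nil_mult a c, one = 0\<rparr>"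

lemma nil_group_simps [simp]:
  "carrier (nil_group a c) = UNIV" "x \<otimes>\<^bsub>nil_group a c\<^esub> y = nil_mult a c x y"
  "\<one>\<^bsub>nil_group a c\<^esub> = 0"
  by (simp_all add: nil_group_def)

lemma nil_mult_assoc: "nil_mult a c (nil_mult a c x y) z = nil_mult a c x (nil_mult a c y z)"
  by (simp add: nil_mult_def vec_eq_iff forall_6 algebra_simps power2_eq_square)

lemma nil_mult_0 [simp]: "nil_mult a c 0 x = x" "nil_mult a c x 0 = x"
  by (simp_all add: nil_mult_def vec_eq_iff forall_6)

lemma nil_mult_inv [simp]: "nil_mult a c (nil_inv a c x) x = 0" "nil_mult a c x (nil_inv a c x) = 0"
  by (simp_all add: nil_mult_def nil_inv_def vec_eq_iff forall_6 algebra_simps power2_eq_square)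

lemma group_nil_group: "group (nil_group a c)"
  by (rule groupI) (auto simp: nil_mult_assoc intro: nil_mult_inv)

lemma inv_nil_group [simp]: "inv\<^bsub>nil_group a c\<^esub> x = nil_inv a c x"
  by (rule group.inv_equality[OF group_nil_group]) simp_all

lemma lie_group_nil_group: "lie_group (nil_group a c)"
proof -
  have "smooth_on (\<lambda>z. nil_mult a c (fst z) (snd z) $ i) UNIV" for i
    using exhaust_6[of i]
    by (elim disjE) (simp_all add: nil_mult_def smooth_on_const smooth_on_add smooth_on_diff smooth_on_mult
      smooth_on_power smooth_on_nth smooth_on_linear bounded_linear_fst bounded_linear_snd)
  then have "smooth_on (\<lambda>z. nil_mult a c (fst z) (snd z)) UNIV"
    by (rule smooth_on_vec)
  moreover have "smooth_on (\<lambda>x. nil_inv a c x $ i) UNIV" for i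
    using exhaust_6[of i]
    by (elim disjE) (simp_all add: nil_inv_def smooth_on_const smooth_on_add smooth_on_diff smooth_on_mult
      smooth_on_minus smooth_on_power smooth_on_nth smooth_on_linear)
  then have "smooth_on (nil_inv a c) UNIV"
    by (rule smooth_on_vec)
  ultimately show ?thesis
    using group_nil_group by (simp add: lie_group_def case_prod_unfold)
qed

text \<open>The first commutators lie in the span of \<open>e\<^sub>3, e\<^sub>4, e\<^sub>5\<close>, the next ones in that of
  \<open>e\<^sub>4, e\<^sub>5\<close>, which is central. It is enough to follow which coordinates vanish.\<close>
lemma nilpotent_nil_group: "nilpotent_group (nil_group a c)"
proof -
  interpret group "nil_group a c" by (rule group_nil_group)
  define H :: "6 set \<Rightarrow> (real^6) set" where "H I = {x. \<forall>i\<in>I. x $ i = 0}" for I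
  have step: "lower_central (nil_group a c) (Suc n) \<subseteq> H I"
    if "lower_central (nil_group a c) n \<subseteq> K" "subgroup (H I) (nil_group a c)"
      "\<And>g h. h \<in> K \<Longrightarrow> nil_mult a c (nil_mult a c (nil_mult a c g h) (nil_inv a c g)) (nil_inv a c h) \<in> H I"
    for n I K
    unfolding lower_central.simps
    using that by (intro generate_subgroup_incl) auto
  have sub: "subgroup (H I) (nil_group a c)" if "I \<in> {{1,2,6}, {1,2,3,6}, {1,2,3,4,5,6}}" for I
    by (rule subgroupI) (use that in \<open>auto simp: H_def nil_mult_def nil_inv_def forall_6 intro!: exI[of _ 0]\<close>)
  have "lower_central (nil_group a c) (Suc 0) \<subseteq> H {1,2,6}"
    by (rule step[of 0 UNIV]) (auto intro!: sub, auto simp: H_def nil_mult_def nil_inv_def)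
  then have "lower_central (nil_group a c) (Suc (Suc 0)) \<subseteq> H {1,2,3,6}"
    by (rule step) (auto intro!: sub, auto simp: H_def nil_mult_def nil_inv_def algebra_simps)
  then have "lower_central (nil_group a c) (Suc (Suc (Suc 0))) \<subseteq> H {1,2,3,4,5,6}"
    by (rule step) (auto intro!: sub, auto simp: H_def nil_mult_def nil_inv_def forall_6 algebra_simps power2_eq_square)
  moreover have "H {1,2,3,4,5,6} = {0}" by (auto simp: H_def vec_eq_iff forall_6)
  moreover have "0 \<in> lower_central (nil_group a c) (Suc n)" for n
    using generate.one[of "nil_group a c"] by simp
  ultimately have "lower_central (nil_group a c) (Suc (Suc (Suc 0))) = {\<one>\<^bsub>nil_group a c\<^esub>}"
    by (metis nil_group_simps(3) insert_absorb insert_not_empty subset_singletonD)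
  then show ?thesis
    using group_nil_group unfolding nilpotent_group_def by blast
qed

definition integer_points :: "(real^'n) set" where
  "integer_points = {x. \<forall>i. x $ i \<in> \<int>}"

lemma discrete_integer_points: "discrete (integer_points :: (real^'n) set)"
proof (rule discreteI)
  fix x :: "real^'n" assume x: "x \<in> integer_points"
  have "y = x" if "y \<in> integer_points" "dist x y < 1" for y
  proof -
    have "\<bar>x $ i - y $ i\<bar> < 1" for i
      using dist_vec_nth_le[of x i y] that(2) by (simp add: dist_real_def)
    moreover have "x $ i - y $ i \<in> \<int>" for i
      using x that(1) by (simp add: integer_points_def)
    ultimately have "x $ i - y $ i = 0" for i
      using Ints_nonzero_abs_less1 by blast
    then show ?thesis by (simp add: vec_eq_iff)
  qed
  with x show "x isolated_in integer_points"
    unfolding isolated_in_dist_Ex_iff using zero_less_one by blast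
qed

lemma subgroup_integer_points:
  assumes "a \<in> \<int>" "c \<in> \<int>"
  shows "subgroup integer_points (nil_group a c)"
  by (rule group.subgroupI[OF group_nil_group])
    (use assms in \<open>auto simp: integer_points_def forall_6 nil_mult_def nil_inv_def intro!: exI[of _ 0]\<close>)

text \<open>Each coordinate of a product \<open>\<gamma> x\<close> is the sum of the corresponding coordinates of \<open>\<gamma>\<close> and \<open>x\<close> and
  of a term in \<open>x\<close> and earlier coordinates of \<open>\<gamma>\<close>, so the coordinates of \<open>\<gamma>\<close> can be chosen one
  after the other to bring those of \<open>\<gamma> x\<close> into the unit interval.\<close>
lemma integer_translate_into_cube:
  "\<exists>\<gamma>\<in>integer_points. nil_mult a c \<gamma> x \<in> cbox 0 1"
proof -
  define f :: "real \<Rightarrow> real" where "f r = - of_int \<lfloor>r\<rfloor>" for r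
  have f: "f r \<in> \<int>" "0 \<le> f r + r" "f r + r \<le> 1" for r
    unfolding f_def by (auto, linarith+)
  define g1 g2 where "g1 = f (x$1)" and "g2 = f (x$2)"
  define g3 where "g3 = f (x$3 + 2 * a * g1 * x$2)"
  define g4 where "g4 = f (x$4 + c * (g1 * x$3 + a * g1^2 * x$2))"
  define g5 where "g5 = f (x$5 - c * (g3 * x$2 + a * g1 * (x$2)^2))"
  define \<gamma> :: "real^6" where "\<gamma> = vector [g1, g2, g3, g4, g5, f (x$6)]"
  have "\<gamma> \<in> integer_points"
    by (simp add: \<gamma>_def integer_points_def forall_6 f g1_def g2_def g3_def g4_def g5_def)
  moreover have "nil_mult a c \<gamma> x \<in> cbox 0 1"
    using f[of "x$1"] f[of "x$2"] f[of "x$3 + 2 * a * g1 * x$2"]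
      f[of "x$4 + c * (g1 * x$3 + a * g1^2 * x$2)"] f[of "x$5 - c * (g3 * x$2 + a * g1 * (x$2)^2)"] f[of "x$6"]
    unfolding mem_box_cart forall_6
    by (simp add: \<gamma>_def nil_mult_def flip: g1_def g2_def g3_def g4_def g5_def)
  ultimately show ?thesis by blast
qed

lemma ex_quotient_topology: "\<exists>Y. quotient_map X Y f"
proof -
  define P where "P U \<longleftrightarrow> U \<subseteq> f ` topspace X \<and> openin X {x \<in> topspace X. f x \<in> U}" for U
  have "istopology P"
    unfolding istopology_def
  proof (intro conjI allI impI)
    fix U V assume "P U" "P V"
    moreover have "{x \<in> topspace X. f x \<in> U \<inter> V} = {x \<in> topspace X. f x \<in> U} \<inter> {x \<in> topspace X. f x \<in> V}"
      by blast
    ultimately show "P (U \<inter> V)" unfolding P_def by auto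
  next
    fix K assume K: "\<forall>U\<in>K. P U"
    moreover have "{x \<in> topspace X. f x \<in> \<Union>K} = \<Union>((\<lambda>U. {x \<in> topspace X. f x \<in> U}) ` K)"
      by blast
    ultimately show "P (\<Union>K)" unfolding P_def by auto
  qed
  then have P: "openin (topology P) = P" by (rule topology_inverse')
  have "P (f ` topspace X)"
  proof -
    have "{x \<in> topspace X. f x \<in> f ` topspace X} = topspace X" by blast
    then show ?thesis by (simp add: P_def)
  qed
  then have "topspace (topology P) = f ` topspace X"
    unfolding topspace_def[of "topology P"] P by (auto simp: P_def)
  then have "quotient_map X (topology P) f"
    unfolding quotient_map_def P by (simp add: P_def)
  then show ?thesis ..
qed

lemma cocompact_integer_points:
  assumes "a \<in> \<int>" "c \<in> \<int>"
  shows "cocompact_lattice (nil_group a c) integer_points"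
proof -
  let ?G = "nil_group a c"
  let ?q = "\<lambda>g. integer_points #>\<^bsub>?G\<^esub> g"
  obtain Y where Y: "quotient_map (top_of_set (carrier ?G)) Y ?q"
    using ex_quotient_topology by blast
  have "topspace Y \<subseteq> ?q ` cbox 0 1"
  proof
    fix y assume "y \<in> topspace Y"
    then obtain x where y: "y = ?q x"
      using quotient_imp_surjective_map[OF Y] by (metis imageE)
    obtain \<gamma> where \<gamma>: "\<gamma> \<in> integer_points" "nil_mult a c \<gamma> x \<in> cbox 0 1"
      using integer_translate_into_cube by blast
    have "?q (nil_mult a c \<gamma> x) = ?q x"
      using \<gamma>(1) group.coset_mult_assoc[OF group_nil_group, of integer_points a c \<gamma> x]
        group.coset_join2[OF group_nil_group _ subgroup_integer_points[OF assms], of \<gamma>] by simp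
    with \<gamma>(2) show "y \<in> ?q ` cbox 0 1" unfolding y by (metis imageI)
  qed
  moreover have "?q ` cbox 0 1 \<subseteq> topspace Y"
    using Y by (auto simp: quotient_map_def)
  moreover have "compactin Y (?q ` cbox 0 1)"
    using Y by (intro image_compactin[OF _ quotient_imp_continuous_map]) (simp_all add: compact_cbox)
  ultimately have "compact_space Y" by (metis compact_space_def subset_antisym)
  with Y show ?thesis
    unfolding cocompact_lattice_def
    using subgroup_integer_points[OF assms] discrete_integer_points by blast
qed

lemma nilmanifold_nil_group:
  assumes "a \<in> \<int>" "c \<in> \<int>"
  shows "nilmanifold (nil_group a c) integer_points"
  unfolding nilmanifold_def
  using lie_group_nil_group nilpotent_nil_group cocompact_integer_points[OF assms]
  by (simp add: convex_imp_simply_connected convex_connected)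

section \<open>The (0,2)-part of the exterior derivative\<close>

lemma row_matrix_mult: "(A ** B) $ i = (A $ i) v* B"
  by (simp add: matrix_matrix_mult_def vector_matrix_mult_def vec_eq_iff)

lemma complexify_mult: "complexify (A ** B) = complexify A ** complexify B"
  by (simp add: matrix_matrix_mult_def vec_eq_iff)

lemma complexify_mat_1 [simp]: "complexify (mat 1) = mat 1"
  by (simp add: mat_def vec_eq_iff)

lemma cmat_scale_mult_left: "cmat_scale c A ** B = cmat_scale c (A ** B)"
  by (simp add: cmat_scale_def matrix_matrix_mult_def vec_eq_iff sum_distrib_left mult.assoc)

lemma cmat_scale_mult_right: "A ** cmat_scale c B = cmat_scale c (A ** B)"
  by (simp add: cmat_scale_def matrix_matrix_mult_def vec_eq_iff sum_distrib_left mult.left_commute)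

lemma matrix_diff_ldistrib: "A ** (B - C) = A ** B - A ** C" for A :: "'a::ring_1^'n^'m"
  by (simp add: matrix_matrix_mult_def vec_eq_iff sum_subtractf right_diff_distrib)

lemma matrix_diff_rdistrib: "(A - B) ** C = A ** C - B ** C" for A :: "'a::ring_1^'n^'m"
  by (simp add: matrix_matrix_mult_def vec_eq_iff sum_subtractf left_diff_distrib)

lemma matrix_add_rdistrib: "(A + B) ** C = A ** C + B ** C" for A :: "'a::semiring_1^'n^'m"
  by (simp add: matrix_matrix_mult_def vec_eq_iff sum.distrib distrib_right)

lemma proj_T01_conjugate:
  assumes "T ** S = mat 1"
  shows "proj_T01 (T ** M ** S) = complexify T ** proj_T01 M ** complexify S"
  using assms by (simp add: proj_T01_def complexify_mult cmat_scale_mult_left cmat_scale_mult_right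
      matrix_add_ldistrib matrix_add_rdistrib flip: complexify_mult)

text \<open>On \<open>T\<^sup>0\<^sup>,\<^sup>1\<close> the structure \<open>J\<close> acts as \<open>-\<i>\<close>, so there \<open>\<alpha> \<circ> J\<close> equals both \<open>\<i>\<alpha>\<close> and \<open>-\<i>\<alpha>\<close>.\<close>
lemma covector_10_proj_T01:
  assumes "\<alpha> v* complexify J = \<i> *s \<alpha>"
  shows "\<alpha> v* proj_T01 J = 0"
proof -
  have "(\<alpha> v* proj_T01 J) $ j = 0" for j
  proof -
    have "(\<Sum>k\<in>UNIV. \<alpha> $ k * (\<i> * of_real (J $ k $ j))) = \<i> * (\<alpha> v* complexify J) $ j"
      by (simp add: vector_matrix_mult_def sum_distrib_left algebra_simps)
    also have "\<dots> = - \<alpha> $ j" by (simp add: assms)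
    finally have "(\<Sum>k\<in>UNIV. \<alpha> $ k * (\<i> * of_real (J $ k $ j))) = - \<alpha> $ j" .
    moreover have "(\<Sum>k\<in>UNIV. \<alpha> $ k * mat 1 $ k $ j) = (\<alpha> v* mat 1) $ j"
      by (simp add: vector_matrix_mult_def)
    moreover have "(\<alpha> v* proj_T01 J) $ j = (1/2) * ((\<Sum>k\<in>UNIV. \<alpha> $ k * mat 1 $ k $ j)
        + (\<Sum>k\<in>UNIV. \<alpha> $ k * (\<i> * of_real (J $ k $ j))))"
      by (simp add: vector_matrix_mult_def proj_T01_def cmat_scale_def sum_distrib_left
          flip: sum.distrib) (simp add: algebra_simps)
    ultimately show ?thesis by simp
  qed
  then show ?thesis by (simp add: vec_eq_iff)
qed

text \<open>The difference \<open>\<delta>\<close> of the two forms vanishes at \<open>x\<close>. Differentiating \<open>\<delta> \<circ> J = \<i> \<delta>\<close> there, the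
  term with the derivative of \<open>J\<close> drops out, so each directional derivative of \<open>\<delta>\<close> is again a
  \<open>(1,0)\<close>-covector and vanishes on \<open>T\<^sup>0\<^sup>,\<^sup>1\<close>. Since \<open>d\<delta>(u, v)\<close> is the antisymmetrised derivative, it
  vanishes as soon as both arguments are in \<open>T\<^sup>0\<^sup>,\<^sup>1\<close>.\<close>
lemma mubar_tensorial:
  assumes J: "J differentiable (at x)"
    and \<omega>: "\<omega> differentiable (at x)" "\<And>y. \<omega> y v* complexify (J y) = \<i> *s \<omega> y"
    and \<eta>: "\<eta> differentiable (at x)" "\<And>y. \<eta> y v* complexify (J y) = \<i> *s \<eta> y"
    and eq: "\<omega> x = \<eta> x"
  shows "mubar J \<omega> x = mubar J \<eta> x"
proof -
  define \<delta> where "\<delta> y = \<omega> y - \<eta> y" for y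
  define \<delta>' where "\<delta>' h = frechet_derivative \<omega> (at x) h - frechet_derivative \<eta> (at x) h" for h
  have D: "(\<delta> has_derivative \<delta>') (at x)"
    unfolding \<delta>_def[abs_def] \<delta>'_def[abs_def] using \<omega>(1) \<eta>(1)
    by (intro has_derivative_diff) (simp_all flip: frechet_derivative_works)
  obtain J' where J': "(J has_derivative J') (at x)" using J differentiable_def by blast
  have \<delta>_10: "\<delta> y v* complexify (J y) = \<i> *s \<delta> y" for y
    by (simp add: \<delta>_def vector_matrix_mult_diff_distrib \<omega>(2) \<eta>(2) vector_ssub_ldistrib)
  have "\<delta>' h v* complexify (J x) = \<i> *s \<delta>' h" for h
  proof -
    have "(\<delta>' h v* complexify (J x)) $ j = \<i> * \<delta>' h $ j" for j
    proof -
      have J'kj: "((\<lambda>y. complex_of_real (J y $ k $ j)) has_derivative (\<lambda>h. of_real (J' h $ k $ j))) (at x)" for k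
        by (intro bounded_linear.has_derivative[OF bounded_linear_of_real]
            bounded_linear.has_derivative[OF bounded_linear_vec_nth] J')
      have \<delta>'k: "((\<lambda>y. \<delta> y $ k) has_derivative (\<lambda>h. \<delta>' h $ k)) (at x)" for k
        by (intro bounded_linear.has_derivative[OF bounded_linear_vec_nth] D)
      have "((\<lambda>y. \<Sum>k\<in>UNIV. \<delta> y $ k * of_real (J y $ k $ j)) has_derivative
          (\<lambda>h. \<Sum>k\<in>UNIV. \<delta> x $ k * of_real (J' h $ k $ j) + \<delta>' h $ k * of_real (J x $ k $ j))) (at x)"
        by (intro has_derivative_sum has_derivative_mult \<delta>'k J'kj)
      moreover have "(\<lambda>y. \<Sum>k\<in>UNIV. \<delta> y $ k * of_real (J y $ k $ j)) = (\<lambda>y. \<i> * \<delta> y $ j)"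
        using \<delta>_10 by (auto simp: vector_matrix_mult_def vec_eq_iff)
      moreover have "((\<lambda>y. \<i> * \<delta> y $ j) has_derivative (\<lambda>h. \<i> * \<delta>' h $ j)) (at x)"
        by (intro has_derivative_mult_right \<delta>'k)
      moreover have "\<delta> x = 0" by (simp add: \<delta>_def eq)
      ultimately have "(\<lambda>h. \<Sum>k\<in>UNIV. \<delta>' h $ k * of_real (J x $ k $ j)) = (\<lambda>h. \<i> * \<delta>' h $ j)"
        by (simp add: has_derivative_unique)
      then show ?thesis by (simp add: vector_matrix_mult_def fun_eq_iff)
    qed
    then show ?thesis by (simp add: vec_eq_iff)
  qed
  then have zero: "\<delta>' h v* proj_T01 (J x) = 0" for h by (rule covector_10_proj_T01)
  define D where "D = (\<chi> i. \<delta>' (axis i 1))"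
  let ?P = "proj_T01 (J x)"
  have "(D ** ?P) $ i = 0" for i by (simp add: row_matrix_mult D_def zero)
  then have DP: "D ** ?P = 0" by (intro vec_eq_iff[THEN iffD2]) simp
  have "ext_d \<omega> x - ext_d \<eta> x = D - transpose D"
    by (simp add: ext_d_def D_def \<delta>'_def transpose_def vec_eq_iff)
  then have "mubar J \<omega> x - mubar J \<eta> x = transpose ?P ** (D - transpose D) ** ?P"
    by (simp add: mubar_def proj02_def flip: matrix_diff_ldistrib matrix_diff_rdistrib)
  also have "\<dots> = transpose ?P ** (D ** ?P) - transpose (D ** ?P) ** ?P"
    by (simp add: matrix_diff_ldistrib matrix_diff_rdistrib matrix_transpose_mul matrix_mul_assoc)
  also have "\<dots> = 0" unfolding DP by (simp add: transpose_def matrix_matrix_mult_def vec_eq_iff)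
  finally show ?thesis by simp
qed

text \<open>Rank and nullity, in the form used for the matrix-valued maps below: if the kernel is a coordinate
  subspace, the map is injective on the complementary coordinate subspace and has the same range there.\<close>
lemma dim_range_linear:
  fixes F :: "complex^'k \<Rightarrow> complex^'n^'m"
  assumes lin: "Vector_Spaces.linear (*s) cmat_scale F"
    and ker: "\<And>q. F q = 0 \<longleftrightarrow> (\<forall>i\<in>d. q $ i = 0)"
  shows "cmat.dim (range F) = card d"
proof -
  interpret finite_dimensional_vector_space_pair_1 "(*s)" cart_basis "cmat_scale :: complex \<Rightarrow> complex^'n^'m \<Rightarrow> _"
    by unfold_locales
  interpret F: Vector_Spaces.linear "(*s)" cmat_scale F by fact
  define D where "D = {q :: complex^'k. \<forall>i. i \<notin> d \<longrightarrow> q $ i = 0}"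
  have sub: "vec.subspace D" by (auto simp: D_def vec.subspace_def)
  have "F q \<in> F ` D" for q
  proof
    let ?r = "\<chi> i. if i \<in> d then q $ i else 0"
    have "F (q - ?r) = 0" by (simp add: ker)
    then show "F q = F ?r" by (simp add: F.diff)
    show "?r \<in> D" by (simp add: D_def)
  qed
  then have "range F = F ` D" by auto
  moreover have "inj_on F D"
  proof (rule inj_onI)
    fix p q assume "p \<in> D" "q \<in> D" "F p = F q"
    then have "F (p - q) = 0" by (simp add: F.diff)
    then have "\<forall>i\<in>d. p $ i = q $ i" unfolding ker by simp
    with \<open>p \<in> D\<close> \<open>q \<in> D\<close> show "p = q" by (force simp: D_def vec_eq_iff)
  qed
  then have "cmat.dim (F ` D) = vec.dim D"
    using sub by (intro dim_image_eq lin) (simp add: vec.span_eq_iff[THEN iffD2])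
  ultimately show ?thesis by (simp add: D_def dim_substandard_cart)
qed

section \<open>Left-invariant structures and forms\<close>

text \<open>The derivative of left translation by \<open>x\<close> at the identity: its columns are the left-invariant
  vector fields extending the standard basis.\<close>
definition nil_frame :: "real \<Rightarrow> real \<Rightarrow> real^6 \<Rightarrow> real^6^6" where
  "nil_frame a c x = vector
    [vector [1, 0, 0, 0, 0, 0],
     vector [0, 1, 0, 0, 0, 0],
     vector [0, 2 * a * x$1, 1, 0, 0, 0],
     vector [0, a * c * (x$1)^2, c * x$1, 1, 0, 0],
     vector [0, - (c * x$3), 0, 0, 1, 0],
     vector [0, 0, 0, 0, 0, 1]]"

text \<open>The rows are the left-invariant 1-forms (Maurer-Cartan forms) dual to the frame.\<close>
definition nil_coframe :: "real \<Rightarrow> real \<Rightarrow> real^6 \<Rightarrow> real^6^6" where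
  "nil_coframe a c x = vector
    [vector [1, 0, 0, 0, 0, 0],
     vector [0, 1, 0, 0, 0, 0],
     vector [0, - (2 * a * x$1), 1, 0, 0, 0],
     vector [0, a * c * (x$1)^2, - (c * x$1), 1, 0, 0],
     vector [0, c * x$3, 0, 0, 1, 0],
     vector [0, 0, 0, 0, 0, 1]]"

lemma nil_frame_coframe [simp]:
  "nil_frame a c x ** nil_coframe a c x = mat 1" "nil_coframe a c x ** nil_frame a c x = mat 1"
  by (simp_all add: nil_frame_def nil_coframe_def vec_eq_iff forall_6 sum_6 matrix_matrix_mult_def
      mat_def power2_eq_square)

lemma complexify_frame_coframe [simp]:
  "complexify (nil_frame a c x) ** complexify (nil_coframe a c x) = mat 1"
  "complexify (nil_coframe a c x) ** complexify (nil_frame a c x) = mat 1"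
  by (simp_all flip: complexify_mult)

lemma nil_frame_0 [simp]: "nil_frame a c 0 = mat 1" "nil_coframe a c 0 = mat 1"
  by (simp_all add: nil_frame_def nil_coframe_def vec_eq_iff forall_6 mat_def)

lemma smooth_frame: "smooth_on (nil_frame a c) UNIV" "smooth_on (nil_coframe a c) UNIV"
proof -
  have "smooth_on (\<lambda>x. nil_frame a c x $ i $ j) UNIV" for i j
    using exhaust_6[of i] exhaust_6[of j]
    by (elim disjE) (simp_all add: nil_frame_def smooth_on_const smooth_on_mult smooth_on_minus
      smooth_on_power smooth_on_nth smooth_on_linear)
  then show "smooth_on (nil_frame a c) UNIV"
    by (intro smooth_on_vec)
  have "smooth_on (\<lambda>x. nil_coframe a c x $ i $ j) UNIV" for i j
    using exhaust_6[of i] exhaust_6[of j]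
    by (elim disjE) (simp_all add: nil_coframe_def smooth_on_const smooth_on_mult smooth_on_minus
      smooth_on_power smooth_on_nth smooth_on_linear)
  then show "smooth_on (nil_coframe a c) UNIV"
    by (intro smooth_on_vec)
qed

text \<open>This is the chain rule for \<open>L\<^sub>g L\<^sub>x = L\<^bsub>gx\<^esub>\<close>.\<close>
lemma dL_nil_group:
  "dL (nil_group a c) g x = nil_frame a c (nil_mult a c g x) ** nil_coframe a c x"
proof -
  let ?D = "nil_frame a c (nil_mult a c g x) ** nil_coframe a c x"
  have nth: "((\<lambda>y::real^6. y $ i) has_derivative (\<lambda>h. h $ i)) (at x)" for i
    by (rule bounded_linear_imp_has_derivative[OF bounded_linear_vec_nth])
  have "((\<lambda>y. nil_mult a c g y $ i) has_derivative (\<lambda>h. (?D *v h) $ i)) (at x)" for i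
    using exhaust_6[of i]
    by (elim disjE) (auto simp: nil_mult_def nil_frame_def nil_coframe_def sum_6 matrix_matrix_mult_def
        matrix_vector_mult_def algebra_simps power2_eq_square intro!: derivative_eq_intros nth)
  then have "(nil_mult a c g has_derivative (\<lambda>h. ?D *v h)) (at x)"
    by (rule has_derivative_vec)
  then have "frechet_derivative (nil_mult a c g) (at x) = (\<lambda>h. ?D *v h)"
    by (metis frechet_derivative_at)
  then show ?thesis by (simp add: dL_def)
qed

definition left_field :: "real \<Rightarrow> real \<Rightarrow> real^6^6 \<Rightarrow> real^6 \<Rightarrow> real^6^6" where
  "left_field a c M x = nil_frame a c x ** M ** nil_coframe a c x"

lemma left_field_0 [simp]: "left_field a c M 0 = M"
  by (simp add: left_field_def)

lemma smooth_left_field: "smooth_on (left_field a c M) UNIV"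
  unfolding left_field_def[abs_def] matrix_matrix_mult_def
  by (intro smooth_on_vec) (simp add: smooth_on_sum smooth_on_mult smooth_on_const smooth_on_nth smooth_frame)

lemma left_field_in_acs:
  assumes "M ** M = - mat 1"
  shows "left_field a c M \<in> left_invariant_acs (nil_group a c)"
proof -
  have "left_field a c M x ** left_field a c M x = - mat 1" for x
  proof -
    have "left_field a c M x ** left_field a c M x
        = nil_frame a c x ** M ** (nil_coframe a c x ** nil_frame a c x) ** M ** nil_coframe a c x"
      by (simp add: left_field_def matrix_mul_assoc del: nil_frame_coframe)
    also have "\<dots> = nil_frame a c x ** (M ** M) ** nil_coframe a c x"
      by (simp add: matrix_mul_assoc)
    also have "\<dots> = - mat 1"
      using matrix_diff_ldistrib[of "nil_frame a c x" 0 "mat 1"] matrix_diff_rdistrib[of 0 "nil_frame a c x" "nil_coframe a c x"]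
      by (simp add: assms)
    finally show ?thesis .
  qed
  moreover have "dL (nil_group a c) g x ** left_field a c M x
      = left_field a c M (nil_mult a c g x) ** dL (nil_group a c) g x" for g x
  proof -
    let ?g = "nil_mult a c g x"
    have "dL (nil_group a c) g x ** left_field a c M x
        = nil_frame a c ?g ** (nil_coframe a c x ** nil_frame a c x) ** M ** nil_coframe a c x"
      by (simp add: left_field_def dL_nil_group matrix_mul_assoc del: nil_frame_coframe)
    also have "\<dots> = nil_frame a c ?g ** M ** (nil_coframe a c ?g ** nil_frame a c ?g) ** nil_coframe a c x"
      by simp
    also have "\<dots> = left_field a c M ?g ** dL (nil_group a c) g x"
      by (simp add: left_field_def dL_nil_group matrix_mul_assoc del: nil_frame_coframe)
    finally show ?thesis .
  qed
  ultimately show ?thesis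
    by (simp add: left_invariant_acs_def almost_complex_structure_def smooth_left_field)
qed

definition left_form :: "real \<Rightarrow> real \<Rightarrow> complex^6 \<Rightarrow> real^6 \<Rightarrow> complex^6" where
  "left_form a c \<alpha> x = \<alpha> v* complexify (nil_coframe a c x)"

text \<open>The 2-form \<open>(u, v) \<mapsto> - \<alpha>([u, v])\<close> on the Lie algebra, which is the exterior derivative of the
  left-invariant form with value \<open>\<alpha>\<close> at the identity, written in the left-invariant frame.\<close>
definition d_left_form :: "real \<Rightarrow> real \<Rightarrow> complex^6 \<Rightarrow> complex^6^6" where
  "d_left_form a c \<alpha> = vector
    [vector [0, - 2 * a * \<alpha>$3, - c * \<alpha>$4, 0, 0, 0],
     vector [2 * a * \<alpha>$3, 0, - c * \<alpha>$5, 0, 0, 0],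
     vector [c * \<alpha>$4, c * \<alpha>$5, 0, 0, 0, 0], 0, 0, 0]"

lemma smooth_left_form: "smooth_on (left_form a c \<alpha>) UNIV"
  unfolding left_form_def[abs_def] vector_matrix_mult_def
  by (intro smooth_on_vec)
    (simp add: smooth_on_sum smooth_on_mult smooth_on_const smooth_on_nth smooth_frame
      smooth_on_linear_compose[OF bounded_linear_of_real])

lemma smooth_on_imp_differentiable: "smooth_on f S \<Longrightarrow> x \<in> S \<Longrightarrow> f differentiable (at x)"
  unfolding smooth_on_def by (metis Ck_on.simps(2))

lemma ext_d_left_form:
  "ext_d (left_form a c \<alpha>) x = transpose (complexify (nil_coframe a c x)) ** d_left_form a c \<alpha>
     ** complexify (nil_coframe a c x)"
proof -
  define D :: "real^6 \<Rightarrow> complex^6" where "D h = vector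
    [0, (2 * a * c * x$1 * h$1) * \<alpha>$4 - (2 * a * h$1) * \<alpha>$3 + (c * h$3) * \<alpha>$5, - (c * h$1) * \<alpha>$4, 0, 0, 0]"
    for h :: "real^6"
  have nth: "((\<lambda>y::real^6. y $ i) has_derivative (\<lambda>h. h $ i)) (at x)" for i
    by (rule bounded_linear_imp_has_derivative[OF bounded_linear_vec_nth])
  have "((\<lambda>y. left_form a c \<alpha> y $ i) has_derivative (\<lambda>h. D h $ i)) (at x)" for i
    using exhaust_6[of i]
    by (elim disjE) (auto simp: left_form_def D_def nil_coframe_def sum_6
        vector_matrix_mult_def algebra_simps power2_eq_square intro!: derivative_eq_intros nth)
  then have "(left_form a c \<alpha> has_derivative D) (at x)"
    by (rule has_derivative_vec)
  then have "frechet_derivative (left_form a c \<alpha>) (at x) = D"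
    by (metis frechet_derivative_at)
  then show ?thesis
    by (simp add: ext_d_def D_def axis_def nil_coframe_def d_left_form_def vec_eq_iff forall_6 sum_6
        matrix_matrix_mult_def transpose_def algebra_simps)
qed

lemma left_form_in_A10:
  assumes "\<alpha> v* complexify M = \<i> *s \<alpha>"
  shows "left_form a c \<alpha> \<in> A10 (nil_group a c) \<Gamma> (left_field a c M)"
proof -
  have "left_form a c \<alpha> (nil_mult a c g x) v* complexify (dL (nil_group a c) g x) = left_form a c \<alpha> x" for g x
  proof -
    let ?g = "nil_mult a c g x"
    have "left_form a c \<alpha> ?g v* complexify (dL (nil_group a c) g x)
      = \<alpha> v* complexify (nil_coframe a c ?g ** nil_frame a c ?g) v* complexify (nil_coframe a c x)"
      by (simp add: left_form_def dL_nil_group complexify_mult vector_matrix_mul_assoc matrix_mul_assoc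
          del: nil_frame_coframe complexify_frame_coframe)
    then show ?thesis by (simp add: left_form_def)
  qed
  moreover have "left_form a c \<alpha> x v* complexify (left_field a c M x) = \<i> *s left_form a c \<alpha> x" for x
  proof -
    have "left_form a c \<alpha> x v* complexify (left_field a c M x)
      = \<alpha> v* complexify (nil_coframe a c x ** nil_frame a c x) v* complexify M v* complexify (nil_coframe a c x)"
      by (simp add: left_form_def left_field_def complexify_mult vector_matrix_mul_assoc matrix_mul_assoc
          del: nil_frame_coframe complexify_frame_coframe)
    then show ?thesis
      by (simp add: assms left_form_def scalar_vector_matrix_assoc)
  qed
  ultimately show ?thesis by (simp add: A10_def smooth_left_form)
qed

text \<open>At a given point, every \<open>(1,0)\<close>-form on the quotient agrees with a left-invariant one, and by
  tensoriality both have the same image under \<open>\<mu>\<close>-bar there.\<close>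
lemma mubar_image_A10:
  "(\<lambda>\<omega>. mubar (left_field a c M) \<omega> x) ` A10 (nil_group a c) \<Gamma> (left_field a c M)
   = (\<lambda>\<alpha>. mubar (left_field a c M) (left_form a c \<alpha>) x) ` {\<alpha>. \<alpha> v* complexify M = \<i> *s \<alpha>}"
proof (intro subset_antisym image_subsetI)
  fix \<omega> assume \<omega>: "\<omega> \<in> A10 (nil_group a c) \<Gamma> (left_field a c M)"
  define \<alpha> where "\<alpha> = \<omega> x v* complexify (nil_frame a c x)"
  have "\<alpha> v* complexify M = \<omega> x v* complexify (left_field a c M x) v* complexify (nil_frame a c x)"
    by (simp add: \<alpha>_def left_field_def complexify_mult vector_matrix_mul_assoc flip: matrix_mul_assoc)
  also have "\<dots> = \<i> *s \<alpha>"
    using \<omega> by (simp add: A10_def \<alpha>_def scalar_vector_matrix_assoc)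
  finally have \<alpha>: "\<alpha> v* complexify M = \<i> *s \<alpha>" .
  have \<eta>: "left_form a c \<alpha> \<in> A10 (nil_group a c) \<Gamma> (left_field a c M)"
    by (rule left_form_in_A10[OF \<alpha>])
  have "mubar (left_field a c M) \<omega> x = mubar (left_field a c M) (left_form a c \<alpha>) x"
  proof (rule mubar_tensorial)
    show "\<omega> x = left_form a c \<alpha> x"
      by (simp add: left_form_def \<alpha>_def vector_matrix_mul_assoc)
  qed (use \<omega> \<eta> in \<open>auto simp: A10_def intro: smooth_on_imp_differentiable[OF smooth_left_field]
      smooth_on_imp_differentiable[of _ UNIV]\<close>)
  with \<alpha> show "mubar (left_field a c M) \<omega> x
      \<in> (\<lambda>\<alpha>. mubar (left_field a c M) (left_form a c \<alpha>) x) ` {\<alpha>. \<alpha> v* complexify M = \<i> *s \<alpha>}"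
    by blast
qed (blast intro: left_form_in_A10)

lemma mubar_left_form:
  "mubar (left_field a c M) (left_form a c \<alpha>) x = transpose (complexify (nil_coframe a c x))
     ** proj02 M (d_left_form a c \<alpha>) ** complexify (nil_coframe a c x)"
proof -
  let ?T = "complexify (nil_frame a c x)" and ?S = "complexify (nil_coframe a c x)" and ?P = "proj_T01 M"
  have "mubar (left_field a c M) (left_form a c \<alpha>) x
      = transpose ?S ** transpose ?P ** transpose (?S ** ?T) ** d_left_form a c \<alpha> ** (?S ** ?T) ** ?P ** ?S"
    unfolding mubar_def proj02_def ext_d_left_form left_field_def proj_T01_conjugate[OF nil_frame_coframe(1)]
    by (simp only: matrix_transpose_mul matrix_mul_assoc)
  then show ?thesis by (simp add: proj02_def matrix_mul_assoc)
qed

lemma congruence_eq_0_iff: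
  fixes Z W :: "complex^_^_"
  assumes "W ** Z = mat 1"
  shows "transpose W ** X ** W = 0 \<longleftrightarrow> X = 0"
proof
  have "X = transpose (W ** Z) ** X ** (W ** Z)" by (simp add: assms)
  also have "\<dots> = transpose Z ** (transpose W ** X ** W) ** Z"
    by (simp only: matrix_transpose_mul matrix_mul_assoc)
  finally have X: "X = transpose Z ** (transpose W ** X ** W) ** Z" .
  assume "transpose W ** X ** W = 0"
  with X have "X = transpose Z ** 0 ** Z" by simp
  then show "X = 0" by (simp add: matrix_matrix_mult_def vec_eq_iff)
qed (simp add: matrix_matrix_mult_def vec_eq_iff)

text \<open>The rows of \<open>Z\<close> are a basis of \<open>T\<^sup>0\<^sup>,\<^sup>1\<close> (in the applications \<open>'m\<close> has three elements), those of \<open>W\<close>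
  the dual basis extended by zero on \<open>T\<^sup>1\<^sup>,\<^sup>0\<close>, and \<open>\<iota>\<close> parametrises the \<open>(1,0)\<close>-covectors. A form is
  determined on \<open>T\<^sup>0\<^sup>,\<^sup>1\<close> by the matrix \<open>Z B Z\<^sup>T\<close> of its values on that basis, here the numbers
  \<open>- \<alpha>([Z\<^sub>i, Z\<^sub>j])\<close>, so the kernel of \<open>\<mu>\<close>-bar can be read off from them. Both \<open>proj02\<close> and the change from
  the frame at \<open>x\<close> to coordinates are congruences and do not change it.\<close>
lemma rk_N_left_field:
  fixes \<iota> :: "complex^'k \<Rightarrow> complex^6" and Z :: "complex^6^'m"
  assumes 10: "{\<alpha>. \<alpha> v* complexify M = \<i> *s \<alpha>} = range \<iota>"
    and lin: "Vector_Spaces.linear (*s) (*s) \<iota>"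
    and P: "proj_T01 M = transpose Z ** W" and WZ: "W ** transpose Z = mat 1"
    and ker: "\<And>q. Z ** d_left_form a c (\<iota> q) ** transpose Z = 0 \<longleftrightarrow> (\<forall>i\<in>d. q $ i = 0)"
  shows "rk_N (nil_group a c) \<Gamma> (left_field a c M) x = card d"
proof -
  let ?T = "complexify (nil_frame a c x)" and ?S = "complexify (nil_coframe a c x)"
  define F where "F q = mubar (left_field a c M) (left_form a c (\<iota> q)) x" for q
  have F: "F q = transpose ?S ** (transpose W ** (Z ** d_left_form a c (\<iota> q) ** transpose Z) ** W) ** ?S" for q
    by (simp add: F_def mubar_left_form proj02_def P matrix_transpose_mul matrix_mul_assoc)
  interpret \<iota>: Vector_Spaces.linear "(*s)" "(*s)" \<iota> by fact
  have d_add: "d_left_form a c (\<alpha> + \<beta>) = d_left_form a c \<alpha> + d_left_form a c \<beta>" for \<alpha> \<beta>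
    by (simp add: d_left_form_def vec_eq_iff forall_6 algebra_simps)
  have d_scale: "d_left_form a c (r *s \<alpha>) = cmat_scale r (d_left_form a c \<alpha>)" for r \<alpha>
    by (simp add: d_left_form_def cmat_scale_def vec_eq_iff forall_6 algebra_simps)
  have "Vector_Spaces.linear (*s) cmat_scale F"
    unfolding Vector_Spaces.linear_iff
    by (simp add: vec.vector_space_axioms cmat.vector_space_axioms F \<iota>.add \<iota>.scale d_add d_scale
        matrix_add_ldistrib matrix_add_rdistrib cmat_scale_mult_left cmat_scale_mult_right)
  moreover have "F q = 0 \<longleftrightarrow> (\<forall>i\<in>d. q $ i = 0)" for q
    unfolding F congruence_eq_0_iff[OF complexify_frame_coframe(2)] congruence_eq_0_iff[OF WZ] by (rule ker)
  ultimately have "cmat.dim (range F) = card d" by (rule dim_range_linear)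
  moreover have "range F = (\<lambda>\<alpha>. mubar (left_field a c M) (left_form a c \<alpha>) x) ` range \<iota>"
    by (auto simp: F_def)
  ultimately show ?thesis unfolding rk_N_def mubar_image_A10 10 by simp
qed

section \<open>Two curves of almost complex structures\<close>

text \<open>\<open>J e\<^sub>1 = e\<^sub>2\<close>, \<open>J e\<^sub>3 = e\<^sub>6\<close>, \<open>J (e\<^sub>4 + t e\<^sub>2) = s e\<^sub>5\<close>; this squares to \<open>-1\<close> for \<open>s = \<plusminus>1\<close>. The space
  \<open>T\<^sup>0\<^sup>,\<^sup>1\<close> is spanned by \<open>Z\<^sub>1 = e\<^sub>1 + \<i>e\<^sub>2\<close>, \<open>Z\<^sub>2 = e\<^sub>4 + t e\<^sub>2 + \<i>s e\<^sub>5\<close> and \<open>Z\<^sub>3 = e\<^sub>3 + \<i>e\<^sub>6\<close>, with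
  brackets \<open>[Z\<^sub>1, Z\<^sub>2] = 2at e\<^sub>3\<close>, \<open>[Z\<^sub>1, Z\<^sub>3] = c (e\<^sub>4 + \<i>e\<^sub>5)\<close> and \<open>[Z\<^sub>2, Z\<^sub>3] = ct e\<^sub>5\<close>.\<close>
definition J_plane :: "real \<Rightarrow> real \<Rightarrow> real^6^6" where
  "J_plane s t = vector
    [vector [0, -1, 0, t, 0, 0],
     vector [1, 0, 0, 0, - (s * t), 0],
     vector [0, 0, 0, 0, 0, -1],
     vector [0, 0, 0, 0, - s, 0],
     vector [0, 0, 0, s, 0, 0],
     vector [0, 0, 1, 0, 0, 0]]"

lemma J_plane_square: "s * s = 1 \<Longrightarrow> J_plane s t ** J_plane s t = - mat 1"
  by (simp add: J_plane_def vec_eq_iff forall_6 sum_6 matrix_matrix_mult_def mat_def)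

text \<open>A \<open>(1,0)\<close>-covector \<open>\<alpha>\<close> is determined by \<open>q = (\<alpha>\<^sub>2, \<alpha>\<^sub>3, \<alpha>\<^sub>5)\<close>, and the left-hand side of the
  hypothesis says that \<open>\<alpha>\<close> vanishes on the three brackets: \<open>\<alpha>\<^sub>4 + \<i>\<alpha>\<^sub>5 = \<i>(1 - s)\<alpha>\<^sub>5 - t\<alpha>\<^sub>2\<close>.\<close>
lemma rk_N_J_plane:
  fixes d :: "3 set"
  assumes s: "s * s = 1"
    and ker: "\<And>q :: complex^3. a * t * q$2 = 0 \<and> c * (\<i> * (1 - s) * q$3 - t * q$1) = 0 \<and> c * t * q$3 = 0
      \<longleftrightarrow> (\<forall>i\<in>d. q $ i = 0)"
  shows "rk_N (nil_group a c) \<Gamma> (left_field a c (J_plane s t)) x = card d"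
proof (rule rk_N_left_field)
  let ?\<iota> = "\<lambda>q :: complex^3. vector [- \<i> * q$1, q$1, q$2, - t * q$1 - \<i> * s * q$3, q$3, \<i> * q$2] :: complex^6"
  let ?Z = "vector [vector [1, \<i>, 0, 0, 0, 0], vector [0, t, 0, 1, \<i> * s, 0],
    vector [0, 0, 1, 0, 0, \<i>]] :: complex^6^3"
  let ?W = "vector [vector [1/2, - \<i>/2, 0, \<i> * t/2, 0, 0], vector [0, 0, 0, 1/2, - \<i> * s/2, 0],
    vector [0, 0, 1/2, 0, 0, - \<i>/2]] :: complex^6^3"
  have s': "complex_of_real s * of_real s = 1" by (simp add: s flip: of_real_mult)
  show "{\<alpha>. \<alpha> v* complexify (J_plane s t) = \<i> *s \<alpha>} = range ?\<iota>"
  proof (intro equalityI subsetI)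
    fix \<alpha> assume "\<alpha> \<in> {\<alpha>. \<alpha> v* complexify (J_plane s t) = \<i> *s \<alpha>}"
    then have e: "\<alpha>$2 = \<i> * \<alpha>$1" "of_real t * \<alpha>$1 + of_real s * \<alpha>$5 = \<i> * \<alpha>$4" "\<alpha>$6 = \<i> * \<alpha>$3"
      by (auto simp: J_plane_def vec_eq_iff forall_6 sum_6 vector_matrix_mult_def algebra_simps)
    have 1: "\<alpha> $ 1 = - \<i> * \<alpha>$2" by (simp add: e(1))
    have "\<alpha> $ 4 = - \<i> * (of_real t * \<alpha>$1 + of_real s * \<alpha>$5)" by (simp add: e(2))
    then have "\<alpha> $ 4 = - t * \<alpha>$2 - \<i> * s * \<alpha>$5" by (simp add: 1 algebra_simps) (simp add: eq_neg_iff_add_eq_0 algebra_simps)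
    with 1 e(3) have "\<alpha> = ?\<iota> (vector [\<alpha>$2, \<alpha>$3, \<alpha>$5])"
      by (simp add: vec_eq_iff forall_6)
    then show "\<alpha> \<in> range ?\<iota>" by blast
  next
    fix \<alpha> assume "\<alpha> \<in> range ?\<iota>"
    then show "\<alpha> \<in> {\<alpha>. \<alpha> v* complexify (J_plane s t) = \<i> *s \<alpha>}"
      by (auto simp: J_plane_def vec_eq_iff forall_6 sum_6 vector_matrix_mult_def algebra_simps s')
  qed
  show "Vector_Spaces.linear (*s) (*s) ?\<iota>"
    by (simp add: Vector_Spaces.linear_iff vec.vector_space_axioms vec_eq_iff forall_6 algebra_simps)
  show "proj_T01 (J_plane s t) = transpose ?Z ** ?W"
    by (simp add: proj_T01_def cmat_scale_def J_plane_def vec_eq_iff forall_6 sum_3 matrix_matrix_mult_def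
        transpose_def mat_def s' algebra_simps)
  show "?W ** transpose ?Z = mat 1"
    by (simp add: vec_eq_iff forall_3 sum_6 matrix_matrix_mult_def transpose_def mat_def s' algebra_simps)
  show "?Z ** d_left_form a c (?\<iota> q) ** transpose ?Z = 0 \<longleftrightarrow> (\<forall>i\<in>d. q $ i = 0)" for q
    unfolding ker[symmetric]
    by (simp add: vec_eq_iff forall_3 sum_6 matrix_matrix_mult_def transpose_def d_left_form_def s'
        algebra_simps) metis
qed

text \<open>\<open>J e\<^sub>1 = e\<^sub>4\<close>, \<open>J e\<^sub>2 = e\<^sub>6\<close>, \<open>J e\<^sub>5 = e\<^sub>3 + t e\<^sub>2\<close>. For \<open>a = c = 1\<close> the space \<open>T\<^sup>0\<^sup>,\<^sup>1\<close> is spanned by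
  \<open>Z\<^sub>1 = e\<^sub>1 + \<i>e\<^sub>4\<close>, \<open>Z\<^sub>2 = e\<^sub>2 + \<i>e\<^sub>6\<close> and \<open>Z\<^sub>3 = e\<^sub>5 + \<i>(e\<^sub>3 + t e\<^sub>2)\<close>, with brackets
  \<open>[Z\<^sub>1, Z\<^sub>2] = 2e\<^sub>3\<close>, \<open>[Z\<^sub>1, Z\<^sub>3] = \<i>(e\<^sub>4 + 2t e\<^sub>3)\<close> and \<open>[Z\<^sub>2, Z\<^sub>3] = \<i>e\<^sub>5\<close>. At \<open>t = 0\<close> the vectors \<open>e\<^sub>3\<close> and
  \<open>e\<^sub>5\<close> span a complex line, which costs exactly one dimension; for \<open>t \<noteq> 0\<close> the three
  brackets are independent modulo \<open>T\<^sup>0\<^sup>,\<^sup>1\<close>.\<close>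
definition J_split :: "real \<Rightarrow> real^6^6" where
  "J_split t = vector
    [vector [0, 0, 0, -1, 0, 0],
     vector [0, 0, 0, 0, t, -1],
     vector [0, 0, 0, 0, 1, 0],
     vector [1, 0, 0, 0, 0, 0],
     vector [0, 0, -1, 0, 0, 0],
     vector [0, 1, - t, 0, 0, 0]]"

lemma J_split_square: "J_split t ** J_split t = - mat 1"
  by (simp add: J_split_def vec_eq_iff forall_6 sum_6 matrix_matrix_mult_def mat_def)

text \<open>Here \<open>q = (\<alpha>\<^sub>2, \<alpha>\<^sub>3, \<alpha>\<^sub>4)\<close>, and vanishing on the brackets means \<open>\<alpha>\<^sub>3 = 0\<close>, \<open>\<alpha>\<^sub>4 + 2t\<alpha>\<^sub>3 = 0\<close> and
  \<open>\<i>\<alpha>\<^sub>5 = t\<alpha>\<^sub>2 + \<alpha>\<^sub>3 = 0\<close>.\<close>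
lemma rk_N_J_split:
  fixes d :: "3 set"
  assumes ker: "\<And>q :: complex^3. q$2 = 0 \<and> q$3 = 0 \<and> t * q$1 = 0 \<longleftrightarrow> (\<forall>i\<in>d. q $ i = 0)"
  shows "rk_N (nil_group 1 1) \<Gamma> (left_field 1 1 (J_split t)) x = card d"
proof (rule rk_N_left_field)
  let ?\<iota> = "\<lambda>q :: complex^3. vector [- \<i> * q$3, q$1, q$2, q$3, - \<i> * t * q$1 - \<i> * q$2, \<i> * q$1] :: complex^6"
  let ?Z = "vector [vector [1, 0, 0, \<i>, 0, 0], vector [0, 1, 0, 0, 0, \<i>],
    vector [0, \<i> * t, \<i>, 0, 1, 0]] :: complex^6^3"
  let ?W = "vector [vector [1/2, 0, 0, - \<i>/2, 0, 0], vector [0, 1/2, - t/2, 0, 0, - \<i>/2],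
    vector [0, 0, - \<i>/2, 0, 1/2, 0]] :: complex^6^3"
  show "{\<alpha>. \<alpha> v* complexify (J_split t) = \<i> *s \<alpha>} = range ?\<iota>"
  proof (intro equalityI subsetI)
    fix \<alpha> assume "\<alpha> \<in> {\<alpha>. \<alpha> v* complexify (J_split t) = \<i> *s \<alpha>}"
    then have e: "\<alpha>$4 = \<i> * \<alpha>$1" "of_real t * \<alpha>$2 + \<alpha>$3 = \<i> * \<alpha>$5" "\<alpha>$6 = \<i> * \<alpha>$2"
      by (auto simp: J_split_def vec_eq_iff forall_6 sum_6 vector_matrix_mult_def algebra_simps)
    have 1: "\<alpha> $ 1 = - \<i> * \<alpha>$4" by (simp add: e(1))
    have "\<alpha> $ 5 = - \<i> * (of_real t * \<alpha>$2 + \<alpha>$3)" by (simp add: e(2))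
    then have "\<alpha> $ 5 = - \<i> * t * \<alpha>$2 - \<i> * \<alpha>$3" by (simp add: algebra_simps) (simp add: eq_neg_iff_add_eq_0 algebra_simps)
    with 1 e(3) have "\<alpha> = ?\<iota> (vector [\<alpha>$2, \<alpha>$3, \<alpha>$4])"
      by (simp add: vec_eq_iff forall_6)
    then show "\<alpha> \<in> range ?\<iota>" by blast
  next
    fix \<alpha> assume "\<alpha> \<in> range ?\<iota>"
    then show "\<alpha> \<in> {\<alpha>. \<alpha> v* complexify (J_split t) = \<i> *s \<alpha>}"
      by (auto simp: J_split_def vec_eq_iff forall_6 sum_6 vector_matrix_mult_def algebra_simps)
  qed
  show "Vector_Spaces.linear (*s) (*s) ?\<iota>"
    by (simp add: Vector_Spaces.linear_iff vec.vector_space_axioms vec_eq_iff forall_6 algebra_simps)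
  show "proj_T01 (J_split t) = transpose ?Z ** ?W"
    by (simp add: proj_T01_def cmat_scale_def J_split_def vec_eq_iff forall_6 sum_3 matrix_matrix_mult_def
        transpose_def mat_def algebra_simps)
  show "?W ** transpose ?Z = mat 1"
    by (simp add: vec_eq_iff forall_3 sum_6 matrix_matrix_mult_def transpose_def mat_def algebra_simps)
  show "?Z ** d_left_form 1 1 (?\<iota> q) ** transpose ?Z = 0 \<longleftrightarrow> (\<forall>i\<in>d. q $ i = 0)" for q
    unfolding ker[symmetric]
    by (auto simp: vec_eq_iff forall_3 sum_6 matrix_matrix_mult_def transpose_def d_left_form_def
        algebra_simps)
qed

lemma rk_N_J_plane_generic:
  assumes "s * s = 1" "t \<noteq> 0"
  shows "rk_N (nil_group a c) \<Gamma> (left_field a c (J_plane s t)) x = (if a = 0 then 0 else 1) + (if c = 0 then 0 else 2)"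
proof -
  have "rk_N (nil_group a c) \<Gamma> (left_field a c (J_plane s t)) x
      = card ((if a = 0 then {} else {2}) \<union> (if c = 0 then {} else {1, 3::3}))"
    using assms by (intro rk_N_J_plane) auto
  then show ?thesis by auto
qed

lemma tendsto_J_plane: "(J_plane s \<longlongrightarrow> J_plane s 0) (at 0)"
proof (intro vec_tendstoI)
  show "((\<lambda>t. J_plane s t $ i $ j) \<longlongrightarrow> J_plane s 0 $ i $ j) (at 0)" for i j
    using exhaust_6[of i] exhaust_6[of j]
    by (elim disjE) (auto simp: J_plane_def intro!: tendsto_eq_intros)
qed

lemma tendsto_J_split: "(J_split \<longlongrightarrow> J_split 0) (at 0)"
proof (intro vec_tendstoI)
  show "((\<lambda>t. J_split t $ i $ j) \<longlongrightarrow> J_split 0 $ i $ j) (at 0)" for i j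
    using exhaust_6[of i] exhaust_6[of j]
    by (elim disjE) (auto simp: J_split_def intro!: tendsto_eq_intros)
qed

section \<open>Jumps of the rank\<close>

text \<open>The topology on left-invariant structures is that of their values at the identity, so continuity
  of a curve of matrices puts nearby members of the curve into any given neighborhood.\<close>
lemma jump_along_curve:
  assumes ac: "a \<in> \<int>" "c \<in> \<int>"
    and sq: "\<And>t. M t ** M t = - mat 1" and cont: "(M \<longlongrightarrow> M 0) (at (0::real))"
    and rk_0: "\<And>x. rk_N (nil_group a c) integer_points (left_field a c (M 0)) x = k\<^sub>0"
    and rk_t: "\<And>t x. t \<noteq> 0 \<Longrightarrow> rk_N (nil_group a c) integer_points (left_field a c (M t)) x = k\<^sub>1"
  shows "\<exists>(G :: (real^6) monoid) \<Gamma>. nilmanifold G \<Gamma> \<and>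
    (\<exists>J\<^sub>0 \<in> left_invariant_acs G.
       (\<forall>x\<in>carrier G. rk_N G \<Gamma> J\<^sub>0 x = k\<^sub>0) \<and>
       (\<forall>U. openin (left_invariant_acs_topology G) U \<and> J\<^sub>0 \<in> U \<longrightarrow>
          (\<exists>J\<in>U. \<forall>x\<in>carrier G. rk_N G \<Gamma> J x = k\<^sub>1)))"
proof -
  let ?G = "nil_group a c" and ?J = "\<lambda>t. left_field a c (M t)"
  have "\<exists>J\<in>U. \<forall>x\<in>carrier ?G. rk_N ?G integer_points J x = k\<^sub>1"
    if U: "openin (left_invariant_acs_topology ?G) U" "?J 0 \<in> U" for U
  proof -
    obtain V where V: "open V" "U = (\<lambda>J. J 0) -` V \<inter> left_invariant_acs ?G"
      using U(1) by (auto simp: left_invariant_acs_topology_def openin_pullback_topology)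
    with U(2) have "M 0 \<in> V" by simp
    with cont V(1) have "\<forall>\<^sub>F t in at 0. M t \<in> V" by (rule topological_tendstoD)
    then have "\<forall>\<^sub>F t in at 0. M t \<in> V \<and> t \<noteq> 0"
      using eventually_neq_at_within by (rule eventually_conj)
    then obtain t where "M t \<in> V" "t \<noteq> 0"
      using eventually_happens[of _ "at (0::real)"] by auto
    with V(2) rk_t show ?thesis
      by (intro bexI[of _ "?J t"]) (auto simp: left_field_in_acs[OF sq])
  qed
  with rk_0 nilmanifold_nil_group[OF ac] left_field_in_acs[OF sq] show ?thesis by blast
qed

theorem proposition5p15:
  fixes k\<^sub>0 k\<^sub>1 :: nat
  assumes "k\<^sub>0 \<in> {0, 1, 2, 3}" and "k\<^sub>1 \<in> {0, 1, 2, 3}" and "k\<^sub>0 \<le> k\<^sub>1"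
  shows "\<exists>(G :: (real^6) monoid) \<Gamma>. nilmanifold G \<Gamma> \<and>
    (\<exists>J\<^sub>0 \<in> left_invariant_acs G.
       (\<forall>x\<in>carrier G. rk_N G \<Gamma> J\<^sub>0 x = k\<^sub>0) \<and>
       (\<forall>U. openin (left_invariant_acs_topology G) U \<and> J\<^sub>0 \<in> U \<longrightarrow>
          (\<exists>J\<in>U. \<forall>x\<in>carrier G. rk_N G \<Gamma> J x = k\<^sub>1)))"
proof -
  \<comment> \<open>\<open>k\<^sub>1 = a + 2c\<close> in binary.\<close>
  define a c :: real where "a = (if odd k\<^sub>1 then 1 else 0)" and "c = (if k\<^sub>1 \<ge> 2 then 1 else 0)"
  have ac: "a \<in> \<int>" "c \<in> \<int>" by (auto simp: a_def c_def)
  have k1: "(if a = 0 then 0 else 1) + (if c = 0 then 0 else 2) = k\<^sub>1"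
    using assms(2) by (auto simp: a_def c_def)
  consider "k\<^sub>0 = k\<^sub>1" | "k\<^sub>0 = 0" | "k\<^sub>0 = 1" "c = 1" | "k\<^sub>0 = 2" "k\<^sub>1 = 3"
    using assms by (auto simp: c_def)
  then show ?thesis
  proof cases
    case 1
    show ?thesis
      by (rule jump_along_curve[OF ac, of "\<lambda>_. J_plane 1 1"])
        (simp_all add: J_plane_square rk_N_J_plane_generic 1 k1)
  next
    case 2
    have "rk_N (nil_group a c) \<Gamma> (left_field a c (J_plane 1 0)) x = 0" for \<Gamma> x
      using rk_N_J_plane[of 1 a 0 c "{}"] by simp
    then show ?thesis
      by (intro jump_along_curve[OF ac, of "J_plane 1"])
        (simp_all add: J_plane_square tendsto_J_plane rk_N_J_plane_generic 2 k1)
  next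
    case 3
    have "rk_N (nil_group a c) \<Gamma> (left_field a c (J_plane (-1) 0)) x = 1" for \<Gamma> x
      using rk_N_J_plane[of "-1" a 0 c "{3}"] 3 by simp
    then show ?thesis
      by (intro jump_along_curve[OF ac, of "J_plane (-1)"])
        (simp_all add: J_plane_square tendsto_J_plane rk_N_J_plane_generic 3(1) k1)
  next
    case 4
    have "rk_N (nil_group 1 1) \<Gamma> (left_field 1 1 (J_split 0)) x = 2" for \<Gamma> x
      using rk_N_J_split[of 0 "{2, 3}"] by simp
    moreover have "rk_N (nil_group 1 1) \<Gamma> (left_field 1 1 (J_split t)) x = 3" if "t \<noteq> 0" for t \<Gamma> x
      using rk_N_J_split[of t UNIV] that by (auto simp: forall_3)
    ultimately show ?thesis
      by (intro jump_along_curve[of 1 1 J_split]) (simp_all add: J_split_square tendsto_J_split 4)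
  qed
qed

end
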